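(* Let $n\geqslant 3$ be an integer and let $q$ be a prime. Let $\vec{a}=(a_1,\ldots,a_n)\in\mathbb{Z}^n$ with $a_i\not\equiv 0\pmod q$ for all $i$, and let $\vec{h}=(h_1,\ldots,h_n)\in\mathbb{N}^n$ with $1\leqslant h_1\leqslant\cdots\leqslant h_n$. Then $$\#\mathcal{U}_{n,q}(\vec{a},\vec{h})\leqslant \left(\frac{h_1h_2h_3}{q}+\frac{h_2^3}{q}+h_2\right)\exp\left(O\left(\frac{\log q}{\log\log q}\right)\right),$$ where the implied constant depends only on $n$.
   Context: $\mathbb{F}_q$ is identified with $\{0,1,\ldots,q-1\}$, and $\|\zeta\|$ is the distance from a real $\zeta$ to the nearest integer. $\mathcal{U}_{n,q}(\vec{a},\vec{h})$ denotes the set of $u\in\mathbb{F}_q$ for which the Bohr set $\{s\in\mathbb{F}_q:\ \|a_j u^{j} s/q\|\leqslant h_j/q,\ j=1,\ldots,n\}$ contains some $s\neq 0$; equivalently, the set of $u\in\mathbb{F}_q$ for which there exist $s\in\{1,\ldots,q-1\}$ and integers $x_j$ with $|x_j|\leqslant h_j$ and $s a_j u^{j}\equiv x_j\pmod q$, $j=1,\ldots,n$. *)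

theory Defs
  imports "HOL-Analysis.Analysis" "HOL-Number_Theory.Number_Theory"
begin

definition nearest_int_dist :: "real \<Rightarrow> real" where
  "nearest_int_dist \<zeta> = infdist \<zeta> \<int>"

text \<open>The field with \<open>q\<close> elements is identified with \<open>{..<q}\<close>. Vectors indexed by
  \<open>1, \<dots>, n\<close> are functions on \<^typ>\<open>nat\<close> whose values outside \<open>{1..n}\<close> are never used.\<close>

definition bohr_set ::
  "nat \<Rightarrow> nat \<Rightarrow> (nat \<Rightarrow> int) \<Rightarrow> (nat \<Rightarrow> nat) \<Rightarrow> nat \<Rightarrow> nat set" where
  "bohr_set n q a h u =
     {s \<in> {..<q}. \<forall>j\<in>{1..n}.
        nearest_int_dist (of_int (a j * int u ^ j * int s) / real q) \<le> real (h j) / real q}"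

definition U_set ::
  "nat \<Rightarrow> nat \<Rightarrow> (nat \<Rightarrow> int) \<Rightarrow> (nat \<Rightarrow> nat) \<Rightarrow> nat set" where
  "U_set n q a h = {u \<in> {..<q}. \<exists>s\<in>bohr_set n q a h u. s \<noteq> 0}"

end

theory Submission
  imports Defs "HOL-Library.Centered_Division" "HOL-Real_Asymp.Real_Asymp"
begin

text \<open>Let \<open>s\<close> witness that \<open>u \<noteq> 0\<close> is counted, and let \<open>x\<^sub>j\<close> be the absolutely least residue of
  \<open>s a\<^sub>j u\<^sup>j\<close> modulo \<open>q\<close>. Then \<open>u\<close> is determined by \<open>x\<^sub>1\<close> and \<open>x\<^sub>2\<close>, and
  \<open>a\<^sub>2\<^sup>2 x\<^sub>1 x\<^sub>3 \<equiv> a\<^sub>1 a\<^sub>3 x\<^sub>2\<^sup>2\<close>. For each of the \<open>2 h\<^sub>2\<close> values of \<open>x\<^sub>2\<close> this puts the product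
  \<open>x\<^sub>1 x\<^sub>3\<close> into one residue class, which leaves at most \<open>2 h\<^sub>1 h\<^sub>3 / q + 1\<close> possible values; as
  \<open>x\<^sub>1\<close> divides this nonzero product of size at most \<open>q\<^sup>2\<close>, the divisor bound finishes the count.\<close>

section \<open>The divisor bound\<close>

definition divisor_count :: "'a :: comm_semiring_1 \<Rightarrow> nat" where
  "divisor_count n = card {d. d dvd n}"

lemma divisor_count_le_self: "divisor_count n \<le> n" if "n > 0" for n :: nat
proof -
  have "{d. d dvd n} \<subseteq> {1..n}"
    using that by (auto dest: dvd_imp_le intro: Suc_leI dvd_pos_nat)
  then have "card {d. d dvd n} \<le> card {1..n}"
    by (intro card_mono) auto
  then show ?thesis
    by (simp add: divisor_count_def)
qed

lemma divisor_count_mult_le: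
  fixes a b :: nat
  assumes "a > 0" "b > 0"
  shows "divisor_count (a * b) \<le> divisor_count a * divisor_count b"
proof -
  have "{d. d dvd a * b} \<subseteq> (\<lambda>(x, y). x * y) ` ({d. d dvd a} \<times> {d. d dvd b})"
    by (force dest: division_decomp)
  then have "card {d. d dvd a * b} \<le> card ({d. d dvd a} \<times> {d. d dvd b})"
    using assms by (intro surj_card_le) auto
  then show ?thesis
    by (simp add: divisor_count_def card_cartesian_product)
qed

lemma divisor_count_prod_le:
  fixes f :: "'a \<Rightarrow> nat"
  assumes "finite A" "\<And>x. x \<in> A \<Longrightarrow> f x > 0"
  shows "divisor_count (prod f A) \<le> (\<Prod>x\<in>A. divisor_count (f x))"
  using assms
proof (induction A rule: finite_induct)
  case empty
  then show ?case by (simp add: divisor_count_def)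
next
  case (insert x A)
  have "divisor_count (f x * prod f A) \<le> divisor_count (f x) * divisor_count (prod f A)"
    using insert.prems by (intro divisor_count_mult_le) (auto intro!: prod_pos)
  also have "\<dots> \<le> divisor_count (f x) * (\<Prod>x\<in>A. divisor_count (f x))"
    using insert.IH insert.prems by (intro mult_left_mono) auto
  finally show ?case
    using insert.hyps by simp
qed

lemma divisor_count_prime_power:
  fixes p :: nat
  assumes "prime p"
  shows "divisor_count (p ^ e) = Suc e"
proof -
  have "{d. d dvd p ^ e} = (\<lambda>i. p ^ i) ` {..e}"
    using assms by (auto simp: divides_primepow_nat le_imp_power_dvd)
  moreover have "inj_on (\<lambda>i. p ^ i) {..e}"
    using prime_gt_1_nat[OF assms] by (auto intro!: inj_onI)
  ultimately show ?thesis
    by (simp add: divisor_count_def card_image)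
qed

lemma divisor_count_le_prod_multiplicity:
  fixes m :: nat
  assumes "m > 0"
  shows "divisor_count m \<le> (\<Prod>p\<in>prime_factors m. Suc (multiplicity p m))"
proof -
  have "divisor_count m = divisor_count (\<Prod>p\<in>prime_factors m. p ^ multiplicity p m)"
    using assms by (simp flip: prime_factorization_nat)
  also have "\<dots> \<le> (\<Prod>p\<in>prime_factors m. divisor_count (p ^ multiplicity p m))"
    by (intro divisor_count_prod_le) (auto dest: in_prime_factors_imp_prime prime_gt_0_nat)
  also have "\<dots> = (\<Prod>p\<in>prime_factors m. Suc (multiplicity p m))"
    by (intro prod.cong refl divisor_count_prime_power) (rule in_prime_factors_imp_prime)
  finally show ?thesis .
qed

lemma divisor_count_int: "divisor_count t = 2 * divisor_count (nat \<bar>t\<bar>)" for t :: int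
proof (cases "t = 0")
  case False
  define D where "D = {d. d dvd nat \<bar>t\<bar>}"
  have "finite D"
    unfolding D_def using False by (intro finite_divisors_nat) simp
  have "0 \<notin> D"
    using False by (simp add: D_def)
  have "{d. d dvd t} = int ` D \<union> (\<lambda>d. - int d) ` D"
  proof (intro subset_antisym subsetI)
    fix d assume "d \<in> {d. d dvd t}"
    then have "nat \<bar>d\<bar> \<in> D"
      by (simp add: D_def nat_abs_dvd_iff)
    moreover have "d = int (nat \<bar>d\<bar>) \<or> d = - int (nat \<bar>d\<bar>)"
      by auto
    ultimately show "d \<in> int ` D \<union> (\<lambda>d. - int d) ` D"
      by blast
  qed (auto simp: D_def dvd_nat_abs_iff)
  moreover have "int ` D \<inter> (\<lambda>d. - int d) ` D = {}"
  proof -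
    have "int x \<noteq> - int d" if "x \<in> D" for x d
      using that \<open>0 \<notin> D\<close> by (cases x) auto
    then show ?thesis
      by auto
  qed
  moreover have "card (int ` D) = card D" "card ((\<lambda>d. - int d) ` D) = card D"
    by (auto intro!: card_image inj_onI)
  ultimately have "card {d. d dvd t} = 2 * card D"
    using \<open>finite D\<close> by (simp add: card_Un_disjoint)
  then show ?thesis
    by (simp add: divisor_count_def D_def)
qed (simp add: divisor_count_def)

lemma multiplicity_le_log:
  fixes m p :: nat and b :: real
  assumes "m > 0" "1 < b" "b \<le> p"
  shows "multiplicity p m \<le> log b m"
proof (rule le_log_of_power)
  have "b ^ multiplicity p m \<le> real (p ^ multiplicity p m)"
    using assms by (simp add: power_mono)
  also have "p ^ multiplicity p m \<le> m"
    using assms(1) by (intro dvd_imp_le multiplicity_dvd)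
  finally show "b ^ multiplicity p m \<le> m"
    by simp
qed fact

lemma Suc_le_power_powr_log:
  fixes x y :: real
  assumes "1 < y" "y \<le> x"
  shows "Suc e \<le> (x ^ e) powr log y 2"
proof -
  have "Suc e \<le> 2 ^ e"
    by (simp add: Suc_leI)
  then have "Suc e \<le> (2 :: real) ^ e"
    by (metis of_nat_le_iff of_nat_numeral of_nat_power)
  also have "\<dots> = (y powr log y 2) ^ e"
    using assms by simp
  also have "\<dots> = (y ^ e) powr log y 2"
    using assms
    by (simp add: powr_power powr_realpow[symmetric] powr_powr mult.commute del: powr_log_cancel)
  also have "\<dots> \<le> (x ^ e) powr log y 2"
    using assms by (intro powr_mono2 power_mono) auto
  finally show ?thesis .
qed

lemma Suc_multiplicity_le:
  fixes m p :: nat and y :: real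
  assumes "m > 0" "p \<ge> 2" "y > 1"
  shows "Suc (multiplicity p m) \<le>
           (if p < y then 1 + log 2 m else 1) * real (p ^ multiplicity p m) powr log y 2"
proof (cases "p < y")
  case True
  have "Suc (multiplicity p m) \<le> 1 + log 2 m"
    using assms multiplicity_le_log[of m 2 p] by simp
  also have "\<dots> = (1 + log 2 m) * 1"
    by simp
  also have "\<dots> \<le> (1 + log 2 m) * real (p ^ multiplicity p m) powr log y 2"
    using assms by (intro mult_left_mono ge_one_powr_ge_zero) auto
  finally show ?thesis
    using True by simp
next
  case False
  then show ?thesis
    using Suc_le_power_powr_log[of y p] assms(3) by simp
qed

text \<open>Only the at most \<open>y\<close> primes below \<open>y\<close> contribute a factor \<open>e + 1\<close> that is not dominated by
  a small power of \<open>p\<^sup>e\<close>.\<close>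

lemma divisor_count_le_powr:
  fixes m :: nat and y :: real
  assumes "m > 0" "y > 1"
  shows "divisor_count m \<le> (1 + log 2 m) powr y * m powr log y 2"
proof -
  define K where "K = 1 + log 2 m"
  define small where "small = {p \<in> prime_factors m. p < y}"
  have "K \<ge> 1"
    using assms(1) by (simp add: K_def)
  have "divisor_count m \<le> (\<Prod>p\<in>prime_factors m. real (Suc (multiplicity p m)))"
    using divisor_count_le_prod_multiplicity[OF assms(1)] by (metis of_nat_le_iff of_nat_prod)
  also have "\<dots> \<le> (\<Prod>p\<in>prime_factors m.
      (if p < y then K else 1) * real (p ^ multiplicity p m) powr log y 2)"
    unfolding K_def using assms
    by (intro prod_mono conjI Suc_multiplicity_le) (auto intro: prime_ge_2_nat)
  also have "\<dots> = (\<Prod>p\<in>prime_factors m. if p < y then K else 1) *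
      real (\<Prod>p\<in>prime_factors m. p ^ multiplicity p m) powr log y 2"
    by (simp add: prod.distrib prod_powr_distrib)
  also have "\<dots> = K powr card small * m powr log y 2"
    using assms(1) \<open>K \<ge> 1\<close>
    by (simp add: prod.If_cases Int_def small_def powr_realpow flip: prime_factorization_nat)
  also have "\<dots> \<le> K powr y * m powr log y 2"
  proof (intro mult_right_mono powr_mono)
    have "small \<subseteq> {1..nat \<lfloor>y\<rfloor>}"
      by (auto simp: small_def Suc_le_eq le_nat_floor intro: prime_factors_gt_0_nat)
    then have "card small \<le> nat \<lfloor>y\<rfloor>"
      using card_mono[of "{1..nat \<lfloor>y\<rfloor>}" small] by simp
    then show "card small \<le> y"
      using assms(2) by linarith
  qed (use \<open>K \<ge> 1\<close> in auto)
  finally show ?thesis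
    by (simp add: K_def)
qed

text \<open>The absolute value keeps the exponent positive at \<open>x = 2\<close>, where \<open>ln (ln x) < 0\<close>.\<close>

definition ln_over_ln_ln :: "real \<Rightarrow> real" where
  "ln_over_ln_ln x = \<bar>ln x / ln (ln x)\<bar>"

lemma exp_1_neq_of_nat: "exp 1 \<noteq> real n"
proof
  assume "exp 1 = real n"
  moreover have "(2 :: real) < exp 1"
    using e_approx_32 by (simp add: abs_if split: if_splits)
  ultimately have "2 < n" "n < 3"
    using e_less_272 by linarith+
  then show False
    by simp
qed

lemma abs_ln_le_self:
  fixes x :: real
  assumes "x \<ge> 2 / 3"
  shows "\<bar>ln x\<bar> \<le> x"
proof -
  have "- ln x \<le> 1 / x - 1"
    using assms ln_le_minus_one[of "1 / x"] by (simp add: ln_div)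
  moreover have "1 / x \<le> 3 / 2"
    using assms by (simp add: field_simps)
  moreover have "ln x \<le> x - 1"
    using assms by (intro ln_le_minus_one) simp
  ultimately show ?thesis
    using assms by linarith
qed

lemma ln_over_ln_ln_ge_1:
  fixes q :: nat
  assumes "q \<ge> 2"
  shows "ln_over_ln_ln q \<ge> 1"
proof -
  have "ln 2 \<le> ln q"
    using assms by simp
  then have ln_ge: "ln q \<ge> 2 / 3"
    using ln2_ge_two_thirds by linarith
  have "exp (ln q) = q"
    using assms by simp
  then have "ln q \<noteq> 1"
    using exp_1_neq_of_nat[of q] by metis
  then have "ln (ln q) \<noteq> 0"
    using ln_ge by simp
  then show ?thesis
    using abs_ln_le_self[OF ln_ge] ln_ge by (simp add: ln_over_ln_ln_def)
qed

lemma divisor_count_le_exp_sqrt_ln: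
  fixes m :: nat and x :: real
  assumes "ln x > 1" "x > 1" "0 < m" "m \<le> x ^ k"
  shows "divisor_count m \<le>
           exp (sqrt (ln x) * ln (1 + k * log 2 x) + 2 * real k * (ln x / ln (ln x)))"
proof -
  define K where "K = 1 + log 2 m"
  have "ln (ln x) > 0"
    using assms(1) by (rule ln_gt_zero)
  have ln_m: "ln m \<le> k * ln x"
    using assms by (simp flip: ln_realpow)
  have "K \<ge> 1"
    using assms(3) by (simp add: K_def)
  have "K \<le> 1 + k * log 2 x"
    using ln_m by (simp add: K_def log_def divide_right_mono)
  then have small_primes: "sqrt (ln x) * ln K \<le> sqrt (ln x) * ln (1 + k * log 2 x)"
    using assms(2) \<open>K \<ge> 1\<close> by (intro mult_left_mono ln_mono) auto
  have "log (sqrt (ln x)) 2 * ln m \<le> 2 / ln (ln x) * (k * ln x)"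
    using ln_m \<open>ln (ln x) > 0\<close> assms ln_2_less_1
    by (intro mult_mono) (auto simp: log_def ln_sqrt divide_simps)
  then have large_primes: "log (sqrt (ln x)) 2 * ln m \<le> 2 * real k * (ln x / ln (ln x))"
    by (simp add: algebra_simps)
  have "divisor_count m \<le> K powr sqrt (ln x) * m powr log (sqrt (ln x)) 2"
    unfolding K_def using assms by (intro divisor_count_le_powr) auto
  also have "\<dots> = exp (sqrt (ln x) * ln K + log (sqrt (ln x)) 2 * ln m)"
    using \<open>K \<ge> 1\<close> assms(3) by (simp add: powr_def exp_add)
  also have "\<dots> \<le> exp (sqrt (ln x) * ln (1 + k * log 2 x) + 2 * real k * (ln x / ln (ln x)))"
    using small_primes large_primes by simp
  finally show ?thesis .
qed

lemma eventually_divisor_count_le_exp: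
  assumes "k > 0"
  shows "\<forall>\<^sub>F x :: real in at_top. \<forall>m :: nat. 0 < m \<longrightarrow> m \<le> x ^ k \<longrightarrow>
           divisor_count m \<le> exp ((2 * real k + 1) * (ln x / ln (ln x)))"
proof -
  have "\<forall>\<^sub>F x :: real in at_top. sqrt (ln x) * ln (1 + k * log 2 x) \<le> ln x / ln (ln x)"
    using assms by real_asymp
  moreover have "\<forall>\<^sub>F x :: real in at_top. x > 1 \<and> ln x > 1"
    by (intro eventually_conj) real_asymp+
  ultimately show ?thesis
  proof eventually_elim
    case (elim x)
    then have "sqrt (ln x) * ln (1 + k * log 2 x) + 2 * real k * (ln x / ln (ln x)) \<le>
        (2 * real k + 1) * (ln x / ln (ln x))"
      by (simp add: algebra_simps)
    then show ?case
      using divisor_count_le_exp_sqrt_ln elim by (meson exp_le_cancel_iff order_trans)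
  qed
qed

lemma divisor_count_le_exp:
  fixes k :: nat
  assumes "k > 0"
  shows "\<exists>C>0. \<forall>q m :: nat. q \<ge> 2 \<longrightarrow> 0 < m \<longrightarrow> m \<le> q ^ k \<longrightarrow>
           divisor_count m \<le> exp (C * ln_over_ln_ln q)"
proof -
  obtain N where large: "\<And>(x :: real) (m :: nat). x \<ge> N \<Longrightarrow> 0 < m \<Longrightarrow> m \<le> x ^ k \<Longrightarrow>
      divisor_count m \<le> exp ((2 * real k + 1) * (ln x / ln (ln x)))"
    using eventually_divisor_count_le_exp[OF assms] unfolding eventually_at_top_linorder by blast
  define C where "C = 2 * real k + 1 + k * ln (max 1 N)"
  have "C > 0"
    by (simp add: C_def add_pos_nonneg)
  have "divisor_count m \<le> exp (C * ln_over_ln_ln q)"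
    if q: "q \<ge> 2" and m: "0 < m" "m \<le> q ^ k" for q m :: nat
  proof (cases "q \<ge> N")
    case True
    have "divisor_count m \<le> exp ((2 * real k + 1) * (ln q / ln (ln q)))"
      using m True by (intro large) (simp_all flip: of_nat_power)
    also have "\<dots> \<le> exp ((2 * real k + 1) * ln_over_ln_ln q)"
      unfolding exp_le_cancel_iff ln_over_ln_ln_def by (intro mult_left_mono abs_ge_self) auto
    also have "\<dots> \<le> exp (C * ln_over_ln_ln q)"
      unfolding exp_le_cancel_iff
      by (intro mult_right_mono) (auto simp: C_def ln_over_ln_ln_def)
    finally show ?thesis .
  next
    case False
    have "divisor_count m \<le> real q ^ k"
      using divisor_count_le_self[OF m(1)] m(2) by (metis le_trans of_nat_le_iff of_nat_power)
    also have "\<dots> \<le> max 1 N ^ k"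
      using False by (intro power_mono) auto
    also have "\<dots> = exp (k * ln (max 1 N))"
      by (simp add: exp_of_nat_mult)
    also have "\<dots> \<le> exp (C * 1)"
      by (simp add: C_def)
    also have "\<dots> \<le> exp (C * ln_over_ln_ln q)"
      using \<open>C > 0\<close> ln_over_ln_ln_ge_1[OF q] by simp
    finally show ?thesis .
  qed
  with \<open>C > 0\<close> show ?thesis
    by blast
qed

section \<open>Points on a modular hyperbola\<close>

lemma card_residue_class_le:
  fixes q H :: nat and T :: "int set"
  assumes "q > 0" and T: "T \<subseteq> {- int H..int H}"
    and cong: "\<And>s t. s \<in> T \<Longrightarrow> t \<in> T \<Longrightarrow> [s = t] (mod int q)"
  shows "card T \<le> 2 * real H / real q + 1"
proof -
  define block where "block t = (t + int H) div int q" for t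
  have "inj_on block T"
  proof
    fix s t assume st: "s \<in> T" "t \<in> T" "block s = block t"
    have "(s + int H) mod int q = (t + int H) mod int q"
      using cong[OF st(1,2)] by (metis cong_add_rcancel cong_def)
    then show "s = t"
      using st(3) unfolding block_def by (metis add_right_cancel div_mult_mod_eq)
  qed
  moreover have "block ` T \<subseteq> {0..int (2 * H) div int q}"
    using \<open>q > 0\<close> T
    by (auto simp: block_def pos_imp_zdiv_nonneg_iff intro!: zdiv_mono1 dest!: subsetD)
  ultimately have "card T \<le> card {0..int (2 * H) div int q}"
    by (intro card_inj_on_le) auto
  also have "\<dots> = (2 * H) div q + 1"
    by (simp flip: of_nat_mult zdiv_int add: nat_add_distrib)
  finally have "card T \<le> real ((2 * H) div q) + 1"
    by linarith
  also have "real ((2 * H) div q) \<le> real (2 * H) / q"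
    by (rule of_nat_div_le_of_nat)
  finally show ?thesis
    by simp
qed

definition linear_cong_solutions :: "nat \<Rightarrow> int \<Rightarrow> int \<Rightarrow> nat \<Rightarrow> int set" where
  "linear_cong_solutions q b c H = {t \<in> {- int H..int H}. [b * t = c] (mod int q)}"

lemma finite_linear_cong_solutions: "finite (linear_cong_solutions q b c H)"
  by (rule finite_subset[of _ "{- int H..int H}"]) (auto simp: linear_cong_solutions_def)

lemma card_linear_cong_solutions_le:
  assumes "q > 0" "coprime b (int q)"
  shows "card (linear_cong_solutions q b c H) \<le> 2 * real H / real q + 1"
proof (rule card_residue_class_le[OF \<open>q > 0\<close>])
  fix s t
  assume "s \<in> linear_cong_solutions q b c H" "t \<in> linear_cong_solutions q b c H"
  then have "[b * s = b * t] (mod int q)"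
    by (auto simp: linear_cong_solutions_def intro: cong_trans cong_sym)
  then show "[s = t] (mod int q)"
    using assms(2) by (simp add: cong_mult_lcancel)
qed (auto simp: linear_cong_solutions_def)

definition modular_hyperbola :: "nat \<Rightarrow> int \<Rightarrow> int \<Rightarrow> nat \<Rightarrow> nat \<Rightarrow> (int \<times> int) set" where
  "modular_hyperbola q b c X Z =
     {(x, z). x \<noteq> 0 \<and> z \<noteq> 0 \<and> \<bar>x\<bar> \<le> int X \<and> \<bar>z\<bar> \<le> int Z \<and> [b * (x * z) = c] (mod int q)}"

lemma finite_modular_hyperbola: "finite (modular_hyperbola q b c X Z)"
  by (rule finite_subset[of _ "{- int X..int X} \<times> {- int Z..int Z}"])
    (auto simp: modular_hyperbola_def)

lemma card_modular_hyperbola_le_sum_divisor_count: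
  "card (modular_hyperbola q b c X Z) \<le>
     (\<Sum>t\<in>linear_cong_solutions q b c (X * Z) - {0}. divisor_count t)"
proof -
  define T where "T = linear_cong_solutions q b c (X * Z) - {0}"
  define S where "S = (SIGMA t:T. {d. d dvd t})"
  have finite_T: "finite T"
    by (simp add: T_def finite_linear_cong_solutions)
  have finite_divisors: "finite {d. d dvd t}" if "t \<in> T" for t
    using that by (intro finite_divisors_int) (simp add: T_def)
  have "\<bar>x * z\<bar> \<le> int (X * Z)" if "(x, z) \<in> modular_hyperbola q b c X Z" for x z
    using that unfolding abs_mult of_nat_mult
    by (intro mult_mono) (auto simp: modular_hyperbola_def)
  then have "(\<lambda>(x, z). (x * z, x)) ` modular_hyperbola q b c X Z \<subseteq> S"
    by (fastforce simp: S_def T_def linear_cong_solutions_def modular_hyperbola_def abs_le_iff)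
  moreover have "inj_on (\<lambda>(x, z). (x * z, x)) (modular_hyperbola q b c X Z)"
    by (auto simp: modular_hyperbola_def inj_on_def)
  ultimately have "card (modular_hyperbola q b c X Z) \<le> card S"
    using finite_T finite_divisors by (intro card_inj_on_le) (auto simp: S_def)
  also have "\<dots> = (\<Sum>t\<in>T. divisor_count t)"
    using finite_T finite_divisors by (simp add: S_def card_SigmaI divisor_count_def)
  finally show ?thesis
    by (simp add: T_def)
qed

lemma card_modular_hyperbola_le:
  fixes D :: real
  assumes "q > 0" "coprime b (int q)" "D \<ge> 0"
    and divisors: "\<And>m :: nat. 0 < m \<Longrightarrow> m \<le> X * Z \<Longrightarrow> divisor_count m \<le> D"
  shows "card (modular_hyperbola q b c X Z) \<le> (2 * (real X * real Z) / real q + 1) * (2 * D)"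
proof -
  define R where "R = linear_cong_solutions q b c (X * Z)"
  have "card (modular_hyperbola q b c X Z) \<le> (\<Sum>t\<in>R - {0}. real (divisor_count t))"
    using card_modular_hyperbola_le_sum_divisor_count[of q b c X Z]
    by (simp add: R_def flip: of_nat_sum)
  also have "\<dots> \<le> (\<Sum>t\<in>R - {0}. 2 * D)"
    using divisors
    by (intro sum_mono) (auto simp: divisor_count_int R_def linear_cong_solutions_def nat_le_iff)
  also have "\<dots> = card (R - {0}) * (2 * D)"
    by simp
  also have "\<dots> \<le> card R * (2 * D)"
    using \<open>D \<ge> 0\<close> by (intro mult_right_mono) (auto intro: card_Diff1_le)
  also have "\<dots> \<le> (2 * (real X * real Z) / real q + 1) * (2 * D)"
    using \<open>D \<ge> 0\<close> card_linear_cong_solutions_le[OF assms(1,2), of c "X * Z"]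
    by (intro mult_right_mono) (auto simp: R_def)
  finally show ?thesis .
qed

section \<open>Residues attached to a point of the Bohr set\<close>

lemma nearest_int_dist_eq_cmod:
  fixes z :: int and q :: nat
  assumes "q > 0"
  shows "nearest_int_dist (z / q) = \<bar>z cmod int q\<bar> / q"
proof -
  define c where "c = z cdiv int q"
  have diff_c: "z / q - c = (z cmod int q) / q"
  proof -
    have "real_of_int z = real q * c + z cmod int q"
      unfolding c_def by (metis mult_cdiv_cmod_eq of_int_add of_int_mult of_int_of_nat_eq)
    then show ?thesis
      using assms by (simp add: field_simps)
  qed
  have "2 * \<bar>z cmod int q\<bar> \<le> int q"
    using abs_cmod_less_equal[of "int q" z] assms by simp
  then have "\<bar>z / q - c\<bar> \<le> 1 / 2"
    using assms unfolding diff_c by (simp add: field_simps)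
  then have "\<bar>z / q - c\<bar> \<le> \<bar>z / q - k\<bar>" for k :: int
    by (cases "k = c") linarith+
  then have "\<bar>z / q - c\<bar> \<le> dist (z / q) a" if "a \<in> \<int>" for a
    using that by (auto simp: dist_real_def elim: Ints_cases)
  then have "\<bar>z / q - c\<bar> \<le> nearest_int_dist (z / q)"
    unfolding nearest_int_dist_def by (subst infdist_notempty) (auto intro: cINF_greatest)
  moreover have "nearest_int_dist (z / q) \<le> \<bar>z / q - c\<bar>"
    unfolding nearest_int_dist_def dist_real_def[symmetric] by (intro infdist_le) auto
  ultimately show ?thesis
    by (simp add: diff_c)
qed

lemma U_set_iff:
  assumes "q > 0"
  shows "u \<in> U_set n q a h \<longleftrightarrow> u < q \<and>
    (\<exists>s. 0 < s \<and> s < q \<and> (\<forall>j\<in>{1..n}. \<bar>(a j * int u ^ j * int s) cmod int q\<bar> \<le> int (h j)))"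
proof -
  have small_iff: "nearest_int_dist (z / q) \<le> k / q \<longleftrightarrow> \<bar>z cmod int q\<bar> \<le> int k" for z k
    unfolding nearest_int_dist_eq_cmod[OF assms] using assms
    by (simp add: divide_le_cancel) linarith
  show ?thesis
    unfolding U_set_def bohr_set_def small_iff by auto
qed

lemma cong_cmod: "[k cmod l = k] (mod l)"
  by (metis cong_iff_dvd_diff cong_sym dvd_triv_left minus_cmod_eq_mult_cdiv)

lemma cong_monomial_quotient:
  fixes a x :: "nat \<Rightarrow> int"
  assumes "[x i = a i * u ^ i * s] (mod m)" "[x j = a j * u ^ j * s] (mod m)" "i \<le> j"
  shows "[a i * x j = u ^ (j - i) * (a j * x i)] (mod m)"
proof -
  have "[a i * x j = a i * (a j * u ^ j * s)] (mod m)"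
    by (intro cong_mult cong_refl assms(2))
  also have "a i * (a j * u ^ j * s) = u ^ (j - i) * (a j * (a i * u ^ i * s))"
    using \<open>i \<le> j\<close> by (simp flip: power_add)
  also have "[\<dots> = u ^ (j - i) * (a j * x i)] (mod m)"
    by (intro cong_mult cong_refl cong_sym[OF assms(1)])
  finally show ?thesis .
qed

lemma cong_monomial_products:
  fixes a x :: "nat \<Rightarrow> int"
  assumes residues: "\<And>r. r \<in> {i, j, k, l} \<Longrightarrow> [x r = a r * u ^ r * s] (mod m)"
    and "i + k = j + l"
  shows "[a j * a l * (x i * x k) = a i * a k * (x j * x l)] (mod m)"
proof -
  have "[a j * a l * (x i * x k) = a j * a l * ((a i * u ^ i * s) * (a k * u ^ k * s))] (mod m)"
    by (intro cong_mult cong_refl residues) auto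
  also have "a j * a l * ((a i * u ^ i * s) * (a k * u ^ k * s)) =
      a j * a l * a i * a k * u ^ (i + k) * s\<^sup>2"
    by (simp add: power_add power2_eq_square)
  also have "\<dots> = a i * a k * ((a j * u ^ j * s) * (a l * u ^ l * s))"
    unfolding \<open>i + k = j + l\<close> by (simp add: power_add power2_eq_square)
  also have "[\<dots> = a i * a k * (x j * x l)] (mod m)"
    by (intro cong_mult cong_refl cong_sym[OF residues]) auto
  finally show ?thesis .
qed

section \<open>Counting\<close>

text \<open>The triples \<open>(x\<^sub>2, x\<^sub>1, x\<^sub>3)\<close>. Least residues are at most \<open>q / 2\<close>, which keeps the product
  \<open>x\<^sub>1 x\<^sub>3\<close> below \<open>q\<^sup>2\<close> even when the \<open>h\<^sub>i\<close> are large.\<close>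

definition residue_triples :: "nat \<Rightarrow> (nat \<Rightarrow> int) \<Rightarrow> (nat \<Rightarrow> nat) \<Rightarrow> (int \<times> int \<times> int) set" where
  "residue_triples q a h =
     (SIGMA y:{- int (h 2)..int (h 2)} - {0}.
        modular_hyperbola q ((a 2)\<^sup>2) (a 1 * a 3 * y\<^sup>2)
          (min (h 1) (q div 2)) (min (h 3) (q div 2)))"

lemma finite_residue_triples: "finite (residue_triples q a h)"
  by (auto simp: residue_triples_def finite_modular_hyperbola)

lemma card_residue_triples_le:
  fixes q :: nat and D :: real
  assumes "q > 0" "coprime (a 2) (int q)"
    and divisors: "\<And>m :: nat. 0 < m \<Longrightarrow> m \<le> q\<^sup>2 \<Longrightarrow> divisor_count m \<le> D"
  shows "card (residue_triples q a h) \<le>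
           2 * real (h 2) * ((2 * (real (h 1) * real (h 3)) / real q + 1) * (2 * D))"
proof -
  let ?X = "min (h 1) (q div 2)" and ?Z = "min (h 3) (q div 2)"
  let ?Y = "{- int (h 2)..int (h 2)} - {0}"
  have "D \<ge> 0"
    using divisors[of 1] \<open>q > 0\<close> by (simp add: order_trans[rotated])
  have "?X * ?Z \<le> q * q"
    by (intro mult_mono) auto
  then have divisors_le: "divisor_count m \<le> D" if "0 < m" "m \<le> ?X * ?Z" for m :: nat
    using that by (intro divisors) (auto simp: power2_eq_square)
  have hyperbola_le: "card (modular_hyperbola q ((a 2)\<^sup>2) c ?X ?Z) \<le>
      (2 * (real (h 1) * real (h 3)) / real q + 1) * (2 * D)" for c
  proof -
    have "card (modular_hyperbola q ((a 2)\<^sup>2) c ?X ?Z) \<le>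
        (2 * (real ?X * real ?Z) / q + 1) * (2 * D)"
      using assms \<open>D \<ge> 0\<close> by (intro card_modular_hyperbola_le divisors_le) auto
    also have "\<dots> \<le> (2 * (real (h 1) * real (h 3)) / real q + 1) * (2 * D)"
      using \<open>D \<ge> 0\<close>
      by (intro mult_right_mono add_right_mono divide_right_mono mult_left_mono mult_mono) auto
    finally show ?thesis .
  qed
  have "real (card (residue_triples q a h)) =
      (\<Sum>y\<in>?Y. real (card (modular_hyperbola q ((a 2)\<^sup>2) (a 1 * a 3 * y\<^sup>2) ?X ?Z)))"
    unfolding residue_triples_def by (subst card_SigmaI) (auto simp: finite_modular_hyperbola)
  also have "\<dots> \<le> (\<Sum>y\<in>?Y. (2 * (real (h 1) * real (h 3)) / real q + 1) * (2 * D))"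
    by (intro sum_mono hyperbola_le)
  also have "\<dots> = 2 * real (h 2) * ((2 * (real (h 1) * real (h 3)) / real q + 1) * (2 * D))"
    by simp
  finally show ?thesis .
qed

lemma U_set_imp_residue_triple:
  assumes "n \<ge> 3" "prime q" and a: "\<forall>i\<in>{1..n}. \<not> int q dvd a i"
    and u: "u \<in> U_set n q a h" "u \<noteq> 0"
  obtains x y z where "(y, x, z) \<in> residue_triples q a h"
    "[a 1 * y = int u * (a 2 * x)] (mod int q)"
proof -
  have "q > 0" "prime (int q)"
    using \<open>prime q\<close> by (auto intro: prime_gt_0_nat)
  then obtain s where "u < q" and s: "0 < s" "s < q"
    and small: "\<And>j. j \<in> {1..n} \<Longrightarrow> \<bar>(a j * int u ^ j * int s) cmod int q\<bar> \<le> int (h j)"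
    using u(1) by (auto simp: U_set_iff)
  define x where "x j = (a j * int u ^ j * int s) cmod int q" for j
  have residue: "[x j = a j * int u ^ j * int s] (mod int q)" for j
    unfolding x_def by (rule cong_cmod)
  have nonzero: "x j \<noteq> 0" if "j \<in> {1..n}" for j
  proof
    assume "x j = 0"
    then have "int q dvd a j * int u ^ j * int s"
      using residue[of j] by (metis cong_dvd_iff dvd_0_right)
    then have "int q dvd a j \<or> int q dvd int u \<or> int q dvd int s"
      using \<open>prime (int q)\<close> by (metis prime_dvd_mult_iff prime_dvd_power)
    then show False
      using a that s \<open>u < q\<close> \<open>u \<noteq> 0\<close> by (auto dest: dvd_imp_le)
  qed
  have bound: "\<bar>x j\<bar> \<le> int (min (h j) (q div 2))" if "j \<in> {1..n}" for j
    using small[OF that] abs_cmod_less_equal[of "int q"] \<open>q > 0\<close>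
    by (simp add: x_def min_def zdiv_int)
  have "[(a 2)\<^sup>2 * (x 1 * x 3) = a 1 * a 3 * (x 2)\<^sup>2] (mod int q)"
    unfolding power2_eq_square by (rule cong_monomial_products[OF residue]) simp
  then have "(x 1, x 3) \<in> modular_hyperbola q ((a 2)\<^sup>2) (a 1 * a 3 * (x 2)\<^sup>2)
      (min (h 1) (q div 2)) (min (h 3) (q div 2))"
    using nonzero bound \<open>n \<ge> 3\<close> by (simp add: modular_hyperbola_def)
  then have "(x 2, x 1, x 3) \<in> residue_triples q a h"
    using nonzero[of 2] bound[of 2] \<open>n \<ge> 3\<close> by (auto simp: residue_triples_def)
  moreover have "[a 1 * x 2 = int u * (a 2 * x 1)] (mod int q)"
    using cong_monomial_quotient[where i = 1 and j = 2, OF residue residue] by simp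
  ultimately show thesis
    by (rule that)
qed

lemma residue_triple_inj:
  assumes "prime q" "\<not> int q dvd a 2" "(y, x, z) \<in> residue_triples q a h" "u < q" "v < q"
    and "[a 1 * y = int u * (a 2 * x)] (mod int q)" "[a 1 * y = int v * (a 2 * x)] (mod int q)"
  shows "u = v"
proof -
  have "x \<noteq> 0" "\<bar>x\<bar> < int q"
    using assms(3) prime_gt_0_nat[OF \<open>prime q\<close>]
    by (auto simp: residue_triples_def modular_hyperbola_def)
  then have "\<not> int q dvd x"
    using dvd_imp_le_int[of x "int q"] by auto
  then have "coprime (a 2 * x) (int q)"
    using assms(1,2) prime_imp_coprime[of "int q" "a 2"] prime_imp_coprime[of "int q" x]
    by (auto simp: coprime_commute)
  moreover have "[int u * (a 2 * x) = int v * (a 2 * x)] (mod int q)"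
    using assms(6,7) by (meson cong_sym cong_trans)
  ultimately have "[u = v] (mod q)"
    by (simp add: cong_mult_rcancel cong_int_iff)
  then show ?thesis
    using \<open>u < q\<close> \<open>v < q\<close> by (simp add: cong_less_modulus_unique_nat)
qed

lemma card_U_set_le_residue_triples:
  assumes "n \<ge> 3" "prime q" and a: "\<forall>i\<in>{1..n}. \<not> int q dvd a i"
  shows "card (U_set n q a h) \<le> 1 + card (residue_triples q a h)"
proof -
  have "card (U_set n q a h - {0}) \<le> card (residue_triples q a h)"
  proof (rule card_le_if_inj_on_rel[OF finite_residue_triples])
    let ?rel = "\<lambda>u (y, x, _). [a 1 * y = int u * (a 2 * x)] (mod int q)"
    show "\<exists>w. w \<in> residue_triples q a h \<and> ?rel u w" if "u \<in> U_set n q a h - {0}" for u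
    proof -
      have "u \<in> U_set n q a h" "u \<noteq> 0"
        using that by auto
      then obtain x y z where "(y, x, z) \<in> residue_triples q a h"
        "[a 1 * y = int u * (a 2 * x)] (mod int q)"
        by (rule U_set_imp_residue_triple[OF assms])
      then show ?thesis
        by (intro exI[of _ "(y, x, z)"]) simp
    qed
    show "u = v" if "u \<in> U_set n q a h - {0}" "v \<in> U_set n q a h - {0}"
      "w \<in> residue_triples q a h" "?rel u w" "?rel v w" for u v w
    proof -
      obtain x y z where w: "w = (y, x, z)"
        by (cases w)
      show ?thesis
        by (rule residue_triple_inj[where x = x and y = y and z = z and a = a and h = h])
          (use \<open>prime q\<close> that a \<open>n \<ge> 3\<close> in \<open>auto simp: w U_set_def\<close>)
    qed
  qed
  then show ?thesis
    using diff_card_le_card_Diff[of "{0}" "U_set n q a h"] by simp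
qed

lemma card_U_set_le:
  fixes D :: real
  assumes "n \<ge> 3" "prime q" and a: "\<forall>i\<in>{1..n}. \<not> int q dvd a i" and "h 2 \<ge> 1"
    and divisors: "\<And>m :: nat. 0 < m \<Longrightarrow> m \<le> q\<^sup>2 \<Longrightarrow> divisor_count m \<le> D"
  shows "card (U_set n q a h) \<le>
           8 * (real (h 1) * real (h 2) * real (h 3) / real q + real (h 2)) * D"
proof -
  have "q > 0" "coprime (a 2) (int q)"
    using assms(1,2) a by (auto simp: coprime_commute prime_imp_coprime prime_gt_0_nat)
  have "D \<ge> 1"
    using divisors[of 1] \<open>q > 0\<close> by (simp add: divisor_count_def)
  then have "1 \<le> h 2 * D"
    using \<open>h 2 \<ge> 1\<close> mult_mono[of 1 "real (h 2)" 1 D] by simp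
  have "card (U_set n q a h) \<le> 1 + card (residue_triples q a h)"
    by (rule card_U_set_le_residue_triples[OF assms(1-3)])
  then have "card (U_set n q a h) \<le> 1 + real (card (residue_triples q a h))"
    by linarith
  also have "\<dots> \<le> 1 + 2 * real (h 2) * ((2 * (real (h 1) * real (h 3)) / real q + 1) * (2 * D))"
    by (intro add_left_mono card_residue_triples_le divisors) fact+
  also have "\<dots> = 1 + 8 * (real (h 1) * real (h 2) * real (h 3) / q) * D + 4 * (h 2 * D)"
    by (simp add: algebra_simps)
  also have "\<dots> \<le> 8 * (real (h 1) * real (h 2) * real (h 3) / real q + real (h 2)) * D"
    using \<open>1 \<le> h 2 * D\<close> by (simp add: algebra_simps)
  finally show ?thesis .
qed

lemma mult_exp_le_exp_add_mult:
  fixes c r t :: real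
  assumes "c \<ge> 0" "r \<ge> 1"
  shows "c * exp (t * r) \<le> exp ((t + c) * r)"
proof -
  have "c \<le> c * r"
    using assms mult_left_mono[of 1 r c] by simp
  also have "\<dots> \<le> exp (c * r)"
    using exp_ge_add_one_self[of "c * r"] by linarith
  finally show ?thesis
    by (simp add: distrib_right exp_add)
qed

lemma card_U_set_le_exp:
  assumes "n \<ge> 3"
  shows "\<exists>C>0. \<forall>(q :: nat) a h. prime q \<longrightarrow> (\<forall>i\<in>{1..n}. \<not> int q dvd a i) \<longrightarrow> h 2 \<ge> 1 \<longrightarrow>
     card (U_set n q a h) \<le>
       (real (h 1) * real (h 2) * real (h 3) / real q + real (h 2)) * exp (C * ln_over_ln_ln q)"
proof -
  obtain C where "C > 0" and divisors: "\<And>q m :: nat. q \<ge> 2 \<Longrightarrow> 0 < m \<Longrightarrow> m \<le> q\<^sup>2 \<Longrightarrow>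
      divisor_count m \<le> exp (C * ln_over_ln_ln q)"
    using divisor_count_le_exp[of 2] by auto
  have "card (U_set n q a h) \<le>
      (real (h 1) * real (h 2) * real (h 3) / real q + real (h 2)) *
        exp ((C + 8) * ln_over_ln_ln q)"
    if "prime q" "\<forall>i\<in>{1..n}. \<not> int q dvd a i" "h 2 \<ge> 1" for q :: nat and a h
  proof -
    let ?M = "real (h 1) * real (h 2) * real (h 3) / real q + real (h 2)"
    have "q \<ge> 2"
      using \<open>prime q\<close> by (rule prime_ge_2_nat)
    have "card (U_set n q a h) \<le> 8 * ?M * exp (C * ln_over_ln_ln q)"
      using \<open>q \<ge> 2\<close> by (intro card_U_set_le assms that divisors)
    also have "\<dots> = ?M * (8 * exp (C * ln_over_ln_ln q))"
      by simp
    also have "\<dots> \<le> ?M * exp ((C + 8) * ln_over_ln_ln q)"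
      by (intro mult_left_mono mult_exp_le_exp_add_mult ln_over_ln_ln_ge_1 \<open>q \<ge> 2\<close>) auto
    finally show ?thesis .
  qed
  then show ?thesis
    using \<open>C > 0\<close> by (intro exI[of _ "C + 8"]) auto
qed

theorem theorem2p2:
  fixes n :: nat
  assumes "n \<ge> 3"
  shows "\<exists>C>0. \<forall>(q::nat) (a::nat \<Rightarrow> int) (h::nat \<Rightarrow> nat).
     prime q \<longrightarrow>
     (\<forall>i\<in>{1..n}. \<not> [a i = 0] (mod int q)) \<longrightarrow>
     1 \<le> h 1 \<longrightarrow> mono_on {1..n} h \<longrightarrow>
     real (card (U_set n q a h)) \<le>
       (real (h 1) * real (h 2) * real (h 3) / real q + real (h 2) ^ 3 / real q + real (h 2))
         * exp (C * \<bar>ln (real q) / ln (ln (real q))\<bar>)"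
proof -
  obtain C where "C > 0" and card_le: "\<And>(q :: nat) a h. prime q \<Longrightarrow>
      \<forall>i\<in>{1..n}. \<not> int q dvd a i \<Longrightarrow> h 2 \<ge> 1 \<Longrightarrow> card (U_set n q a h) \<le>
        (real (h 1) * real (h 2) * real (h 3) / real q + real (h 2)) * exp (C * ln_over_ln_ln q)"
    using card_U_set_le_exp[OF assms] by blast
  show ?thesis
  proof (intro exI[of _ C] conjI allI impI)
    fix q :: nat and a :: "nat \<Rightarrow> int" and h :: "nat \<Rightarrow> nat"
    assume q: "prime q" and a: "\<forall>i\<in>{1..n}. \<not> [a i = 0] (mod int q)"
      and h: "1 \<le> h 1" "mono_on {1..n} h"
    have "h 1 \<le> h 2"
      using assms by (intro monotone_onD[OF h(2)]) auto
    with h(1) have "h 2 \<ge> 1"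
      by (rule order_trans)
    with q a have "card (U_set n q a h) \<le>
        (real (h 1) * real (h 2) * real (h 3) / real q + real (h 2)) * exp (C * ln_over_ln_ln q)"
      by (intro card_le) (auto simp: cong_0_iff)
    also have "\<dots> \<le> (real (h 1) * real (h 2) * real (h 3) / real q + real (h 2) ^ 3 / real q
        + real (h 2)) * exp (C * ln_over_ln_ln q)"
      by (intro mult_right_mono) auto
    finally show "card (U_set n q a h) \<le> (real (h 1) * real (h 2) * real (h 3) / real q +
        real (h 2) ^ 3 / real q + real (h 2)) * exp (C * \<bar>ln (real q) / ln (ln (real q))\<bar>)"
      unfolding ln_over_ln_ln_def .
  qed fact
qed

end
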